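(* Let $G$ be a finite simple graph with $q$ edges. (Sufficiency) Suppose that $q$ is even and that $G$ has $\frac{q}{2}$ mutually disjoint $\langle xyz\rangle$ paths such that no cycle of $G$ contains an odd number of these paths. Then the line graph $L(G)$ is a 2-variegated graph. (Converse) If $L(G)$ is a 2-variegated graph with $2n$ vertices, then $G$ has $n$ mutually disjoint $\langle xyz\rangle$ paths such that no cycle of $G$ contains an odd number of these paths.
   Context: All graphs are finite, without loops or multiple edges. A graph $B$ with $2n$ vertices is 2-variegated (bivariegated) if its vertex set can be partitioned into two parts of equal size $n$ such that each vertex of either part is adjacent to exactly one vertex of the other part (adjacencies inside a part are unrestricted). The line graph $L(G)$ has the edges of $G$ as vertices, two of them being adjacent in $L(G)$ if and only if the corresponding edges of $G$ share an endpoint. An $\langle xyz\rangle$ path in $G$ is a path of length 2 with edges $xy$ and $yz$ on three distinct vertices $x,y,z$ that is an induced subgraph of $G$ (so $x$ and $z$ are not adjacent in $G$) and whose middle vertex $y$ has degree exactly $2$ in $G$. Two paths are disjoint if they have no common edge. A cycle contains (a path lies on a cycle) an $\langle xyz\rangle$ path if both edges of the path are edges of the cycle. *)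

theory Defs
  imports Main
begin

text \<open>Edges are two-element sets of vertices, so loops and multiple edges cannot occur, and
  the vertices of the line graph are literally the edges of the graph.\<close>

record 'v graph =
  verts :: "'v set"
  edges :: "'v set set"

definition simple_graph :: "'v graph \<Rightarrow> bool" where
  "simple_graph G \<longleftrightarrow> finite (verts G) \<and> (\<forall>e\<in>edges G. e \<subseteq> verts G \<and> card e = 2)"

definition adjacent :: "'v graph \<Rightarrow> 'v \<Rightarrow> 'v \<Rightarrow> bool" where
  "adjacent G u v \<longleftrightarrow> {u, v} \<in> edges G"

definition degree :: "'v graph \<Rightarrow> 'v \<Rightarrow> nat" where
  "degree G v = card {e \<in> edges G. v \<in> e}"

definition induced_subgraph :: "'v graph \<Rightarrow> 'v set \<Rightarrow> 'v graph" where
  "induced_subgraph G W = \<lparr>verts = verts G \<inter> W, edges = {e \<in> edges G. e \<subseteq> W}\<rparr>"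

definition line_graph :: "'v graph \<Rightarrow> 'v set graph" where
  "line_graph G = \<lparr>verts = edges G,
     edges = {{e, f} | e f. e \<in> edges G \<and> f \<in> edges G \<and> e \<noteq> f \<and> e \<inter> f \<noteq> {}}\<rparr>"

definition two_variegated :: "'v graph \<Rightarrow> bool" where
  "two_variegated B \<longleftrightarrow>
     (\<exists>X Y. X \<union> Y = verts B \<and> X \<inter> Y = {} \<and> card X = card Y \<and>
        (\<forall>x\<in>X. \<exists>!y. y \<in> Y \<and> adjacent B x y) \<and>
        (\<forall>y\<in>Y. \<exists>!x. x \<in> X \<and> adjacent B y x))"

text \<open>A path of length 2 with middle vertex \<open>y\<close> is written as a triple \<open>(x, y, z)\<close>. The triples
  \<open>(x, y, z)\<close> and \<open>(z, y, x)\<close> denote the same path; they have the same edges, so an edge-disjoint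
  family contains at most one of them and its cardinality counts paths.\<close>

fun path_edges :: "'v \<times> 'v \<times> 'v \<Rightarrow> 'v set set" where
  "path_edges (x, y, z) = {{x, y}, {y, z}}"

fun xyz_path :: "'v graph \<Rightarrow> 'v \<times> 'v \<times> 'v \<Rightarrow> bool" where
  "xyz_path G (x, y, z) \<longleftrightarrow> distinct [x, y, z] \<and>
     induced_subgraph G {x, y, z} = \<lparr>verts = {x, y, z}, edges = {{x, y}, {y, z}}\<rparr> \<and>
     degree G y = 2"

text \<open>A cycle is given by the list of its vertices in cyclic order, without repeating the first
  one at the end.\<close>

definition cycle_edges :: "'v list \<Rightarrow> 'v set set" where
  "cycle_edges c = {{c ! i, c ! (Suc i mod length c)} | i. i < length c}"

definition is_cycle :: "'v graph \<Rightarrow> 'v list \<Rightarrow> bool" where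
  "is_cycle G c \<longleftrightarrow> 3 \<le> length c \<and> distinct c \<and> set c \<subseteq> verts G \<and> cycle_edges c \<subseteq> edges G"

definition disjoint_xyz_paths :: "'v graph \<Rightarrow> ('v \<times> 'v \<times> 'v) set \<Rightarrow> bool" where
  "disjoint_xyz_paths G P \<longleftrightarrow> finite P \<and> (\<forall>p\<in>P. xyz_path G p) \<and>
     pairwise (\<lambda>p p'. disjnt (path_edges p) (path_edges p')) P"

definition no_odd_cycle :: "'v graph \<Rightarrow> ('v \<times> 'v \<times> 'v) set \<Rightarrow> bool" where
  "no_odd_cycle G P \<longleftrightarrow>
     \<not> (\<exists>c. is_cycle G c \<and> odd (card {p \<in> P. path_edges p \<subseteq> cycle_edges c}))"

lemma simple_graph_line_graph:
  assumes "simple_graph G"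
  shows "simple_graph (line_graph G)"
proof -
  have "edges G \<subseteq> Pow (verts G)" "finite (verts G)"
    using assms by (auto simp: simple_graph_def)
  then have "finite (edges G)"
    by (meson finite_Pow_iff finite_subset)
  moreover have "card {e, f} = 2" if "e \<noteq> f" for e f :: "'a set"
    using that by (rule card_2_iff[THEN iffD2, OF exI, OF exI, OF conjI, OF refl])
  ultimately show ?thesis
    by (auto simp only: simple_graph_def line_graph_def graph.select_convs)
qed

lemma xyz_path_iff:
  assumes "simple_graph G"
  shows "xyz_path G (x, y, z) \<longleftrightarrow> distinct [x, y, z] \<and> {x, y} \<in> edges G \<and> {y, z} \<in> edges G \<and>
     {x, z} \<notin> edges G \<and> degree G y = 2"
proof -
  have E: "e \<subseteq> verts G \<and> card e = 2" if "e \<in> edges G" for e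
    using assms that by (auto simp: simple_graph_def)
  have "e = {x, y} \<or> e = {y, z} \<or> e = {x, z}" if e: "e \<in> edges G" "e \<subseteq> {x, y, z}" for e
  proof -
    obtain a b where "e = {a, b}" "a \<noteq> b" using E[OF e(1)] by (meson card_2_iff)
    then show ?thesis using e(2) by auto
  qed
  then have ind: "{e \<in> edges G. e \<subseteq> {x, y, z}} = edges G \<inter> {{x, y}, {y, z}, {x, z}}"
    by auto
  show ?thesis
  proof (cases "distinct [x, y, z]")
    case True
    then have "{x, z} \<noteq> {x, y}" "{x, z} \<noteq> {y, z}"
      by (auto simp: doubleton_eq_iff)
    moreover have "S \<inter> {a, b, c} = {a, b} \<longleftrightarrow> a \<in> S \<and> b \<in> S \<and> c \<notin> S"
      if "c \<noteq> a" "c \<noteq> b" for S :: "'a set set" and a b c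
      using that by auto
    ultimately have eq: "edges G \<inter> {{x, y}, {y, z}, {x, z}} = {{x, y}, {y, z}} \<longleftrightarrow>
        {x, y} \<in> edges G \<and> {y, z} \<in> edges G \<and> {x, z} \<notin> edges G"
      by simp
    have "verts G \<inter> {x, y, z} = {x, y, z}" if "{x, y} \<in> edges G" "{y, z} \<in> edges G"
      using E[OF that(1)] E[OF that(2)] by auto
    then show ?thesis
      using True by (simp only: xyz_path.simps induced_subgraph_def ind graph.ext_inject eq) argo
  qed auto
qed

end

theory Submission
  imports Defs
begin

text \<open>If \<open>L(G)\<close> is 2-variegated with parts \<open>X\<close> and \<open>Y\<close>, an edge of \<open>X\<close> and an edge of \<open>Y\<close> meeting
  in \<open>y\<close> are the only edges at \<open>y\<close>; these vertices \<open>y\<close> are the middles of the required paths, and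
  a cycle passes through one of them exactly where its edges change between \<open>X\<close> and \<open>Y\<close>, which
  happens an even number of times.

  Conversely, \<open>q/2\<close> disjoint paths cover all edges, so \<open>G\<close> arises from the graph \<open>H\<close> joining the two
  ends of each path by subdividing every edge once. An odd cycle of \<open>H\<close> would give a cycle of \<open>G\<close>
  with an odd number of paths, so \<open>H\<close> is bipartite, and the edges of \<open>G\<close> are split according to the
  colour of their end in \<open>H\<close>.\<close>

section \<open>Graphs without odd cycles\<close>

text \<open>A repeated vertex splits a closed walk into two shorter closed walks whose lengths add
  up to the original one, so one of them is odd again. A single vertex related to itself counts as
  an odd cycle here.\<close>

lemma odd_closed_walk_imp_odd_cycle:
  assumes "successively Q (w @ [hd w])" and "odd (length w)"
  shows "\<exists>c. distinct c \<and> odd (length c) \<and> successively Q (c @ [hd c])"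
  using assms
proof (induction "length w" arbitrary: w rule: less_induct)
  case less
  show ?case
  proof (cases "distinct w")
    case True
    then show ?thesis using less.prems by blast
  next
    case False
    then obtain a v b d where w: "w = a @ [v] @ b @ [v] @ d"
      using not_distinct_decomp by blast
    have 1: "successively Q ((v # b) @ [hd (v # b)])"
      using less.prems(1) unfolding w
      by (cases b) (auto simp: successively_append_iff successively_Cons hd_append)
    have 2: "successively Q ((a @ v # d) @ [hd (a @ v # d)])"
      using less.prems(1) unfolding w
      by (cases a; cases d) (auto simp: successively_append_iff successively_Cons hd_append)
    have "odd (length (v # b)) \<or> odd (length (a @ v # d))"
      using less.prems(2) unfolding w by auto
    then show ?thesis
      using less.hyps[of "v # b"] less.hyps[of "a @ v # d"] 1 2 w by auto
  qed
qed

text \<open>The last vertex is kept apart from \<open>p\<close>, so that for \<open>u = v\<close>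
  and \<open>n > 0\<close> the list \<open>p @ [v]\<close> is a closed walk in the form
  \<open>p @ [hd p]\<close>.\<close>

lemma relpow_imp_walk:
  "(u, v) \<in> R ^^ n \<Longrightarrow>
    \<exists>p. length p = n \<and> hd (p @ [v]) = u \<and> successively (\<lambda>x y. (x, y) \<in> R) (p @ [v])"
proof (induction n arbitrary: v)
  case 0
  then show ?case by auto
next
  case (Suc n)
  then obtain t where t: "(u, t) \<in> R ^^ n" "(t, v) \<in> R" by auto
  from Suc.IH[OF t(1)] obtain p where
    "length p = n" "hd (p @ [t]) = u" "successively (\<lambda>x y. (x, y) \<in> R) (p @ [t])" by blast
  with t(2) show ?case
    by (intro exI[of _ "p @ [t]"]) (auto simp: successively_append_iff hd_append)
qed

lemma sym_relpow: "sym R \<Longrightarrow> sym (R ^^ n)"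
proof (induction n)
  case (Suc n)
  show ?case
  proof (rule symI)
    fix x y assume "(x, y) \<in> R ^^ Suc n"
    then obtain t where "(x, t) \<in> R ^^ n" "(t, y) \<in> R" by auto
    then have "(y, t) \<in> R" "(t, x) \<in> R ^^ n"
      using Suc by (auto dest: symD)
    then show "(y, x) \<in> R ^^ Suc n" by (rule relpow_Suc_I2)
  qed
qed (auto simp: sym_def)

text \<open>A vertex is coloured by the parity of the walks reaching it from a chosen root of its
  component. Two such walks of different parity would join up to an odd closed walk.\<close>

lemma two_colouring_if_no_odd_cycle:
  assumes "sym R"
    and no_odd: "\<And>c. \<lbrakk>distinct c; odd (length c); successively (\<lambda>x y. (x, y) \<in> R) (c @ [hd c])\<rbrakk> \<Longrightarrow> False"
  shows "\<exists>col :: 'a \<Rightarrow> bool. \<forall>x y. (x, y) \<in> R \<longrightarrow> col x \<noteq> col y"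
proof -
  have even_closed: "even n" if "(u, u) \<in> R ^^ n" for u n
  proof (rule ccontr)
    assume "odd n"
    from relpow_imp_walk[OF that] obtain p where p: "length p = n" "hd (p @ [u]) = u"
      "successively (\<lambda>x y. (x, y) \<in> R) (p @ [u])" by blast
    with \<open>odd n\<close> have "hd p = u" by (cases p) auto
    with p \<open>odd n\<close> odd_closed_walk_imp_odd_cycle[of "\<lambda>x y. (x, y) \<in> R" p] no_odd
    show False by auto
  qed
  \<comment> \<open>The predicate under \<open>SOME\<close> is the same for all vertices of a
    component, hence so is the root.\<close>
  define root where "root v = (SOME r. (v, r) \<in> R\<^sup>*)" for v
  have root: "(v, root v) \<in> R\<^sup>*" for v
    unfolding root_def by (rule someI[of _ v]) simp
  define col where "col v \<longleftrightarrow> (\<exists>n. even n \<and> (root v, v) \<in> R ^^ n)" for v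
  have "col x \<noteq> col y" if xy: "(x, y) \<in> R" for x y
  proof -
    have yx: "(y, x) \<in> R" using xy \<open>sym R\<close> by (auto dest: symD)
    have "(x, r) \<in> R\<^sup>* \<longleftrightarrow> (y, r) \<in> R\<^sup>*" for r
      using xy yx by (meson converse_rtrancl_into_rtrancl)
    then have same: "root x = root y" by (simp add: root_def)
    obtain n where "(x, root x) \<in> R ^^ n" using root rtrancl_imp_relpow by metis
    then have n: "(root x, x) \<in> R ^^ n" using sym_relpow[OF \<open>sym R\<close>] by (auto dest: symD)
    then have n': "(root x, y) \<in> R ^^ Suc n" using xy by auto
    have parity: "even j \<longleftrightarrow> even k" if "(root x, v) \<in> R ^^ j" "(root x, v) \<in> R ^^ k" for j k v
    proof -
      have "(v, root x) \<in> R ^^ k" using that(2) sym_relpow[OF \<open>sym R\<close>] by (auto dest: symD)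
      with that(1) have "(root x, root x) \<in> R ^^ (j + k)" by (auto simp: relpow_add)
      then show ?thesis using even_closed by fastforce
    qed
    have "col x \<longleftrightarrow> even n" unfolding col_def using n parity by blast
    moreover have "col y \<longleftrightarrow> even (Suc n)"
      unfolding col_def same[symmetric] using n' parity by blast
    ultimately show ?thesis by simp
  qed
  then show ?thesis by blast
qed

section \<open>Cyclic sequences\<close>

lemma even_card_changes:
  fixes f :: "nat \<Rightarrow> bool"
  shows "even (card {i. i < n \<and> f i \<noteq> f (Suc i)}) \<longleftrightarrow> f 0 = f n"
proof (induction n)
  case (Suc n)
  have "{i. i < Suc n \<and> f i \<noteq> f (Suc i)} =
    (if f n \<noteq> f (Suc n) then insert n {i. i < n \<and> f i \<noteq> f (Suc i)} else {i. i < n \<and> f i \<noteq> f (Suc i)})"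
    by (auto simp: less_Suc_eq)
  then show ?case using Suc by auto
qed simp

text \<open>Reading \<open>f\<close> at \<open>i mod k\<close> makes the sequence periodic, so its
  values at \<open>0\<close> and \<open>k\<close> agree.\<close>

lemma even_card_cyclic_changes:
  fixes f :: "nat \<Rightarrow> bool"
  shows "even (card {i. i < k \<and> f i \<noteq> f (Suc i mod k)})"
proof -
  have "{i. i < k \<and> f i \<noteq> f (Suc i mod k)} = {i. i < k \<and> f (i mod k) \<noteq> f (Suc i mod k)}"
    by auto
  then show ?thesis using even_card_changes[of k "\<lambda>i. f (i mod k)"] by simp
qed

lemma Suc_mod_inj:
  assumes "a < k" "b < k" "Suc a mod k = Suc b mod k"
  shows "a = b"
  using assms by (auto simp: mod_Suc split: if_splits)

text \<open>Pairs that agree crosswise would make \<open>i\<close> and \<open>j\<close> successors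
  of each other, which is impossible on three or more positions.\<close>

lemma cyclic_pair_inj:
  assumes "distinct c" "3 \<le> length c" "i < length c" "j < length c"
    and "{c ! i, c ! (Suc i mod length c)} = {c ! j, c ! (Suc j mod length c)}"
  shows "i = j"
proof -
  have "0 < length c" using assms(2) by linarith
  then have "Suc i mod length c < length c" "Suc j mod length c < length c" by simp_all
  with assms have "i = j \<or> (i = Suc j mod length c \<and> j = Suc i mod length c)"
    by (auto simp: doubleton_eq_iff nth_eq_iff_index_eq)
  then show ?thesis using assms(2-4) by (auto simp: mod_Suc split: if_splits)
qed

text \<open>The common vertex \<open>y\<close> cannot be the first vertex of both cycle edges, nor
  the second of both, since the successor map is injective. The two remaining cases are the two
  directions of traversal.\<close>

lemma cycle_corner:
  assumes "distinct c" "a < length c" "b < length c"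
    and "{x, y} = {c ! a, c ! (Suc a mod length c)}"
    and "{y, z} = {c ! b, c ! (Suc b mod length c)}"
    and "{x, y} \<noteq> {y, z}"
  shows "(b = Suc a mod length c \<and> x = c ! a \<and> y = c ! b \<and> z = c ! (Suc b mod length c)) \<or>
    (a = Suc b mod length c \<and> z = c ! b \<and> y = c ! a \<and> x = c ! (Suc a mod length c))"
proof -
  have "0 < length c" using assms by auto
  then have lt: "Suc a mod length c < length c" "Suc b mod length c < length c" by simp_all
  have "a \<noteq> b" using assms by auto
  then have "Suc a mod length c \<noteq> Suc b mod length c"
    using Suc_mod_inj assms(2,3) by blast
  with \<open>a \<noteq> b\<close> lt assms show ?thesis
    by (auto simp: doubleton_eq_iff nth_eq_iff_index_eq)
qed

section \<open>Line graphs and paths\<close>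

lemma finite_edges: "simple_graph G \<Longrightarrow> finite (edges G)"
  by (rule finite_subset[of _ "Pow (verts G)"]) (auto simp: simple_graph_def)

lemma adjacent_line_graph:
  "adjacent (line_graph G) e f \<longleftrightarrow> e \<in> edges G \<and> f \<in> edges G \<and> e \<noteq> f \<and> e \<inter> f \<noteq> {}"
  unfolding adjacent_def line_graph_def by (auto simp: doubleton_eq_iff)

lemma verts_line_graph [simp]: "verts (line_graph G) = edges G"
  by (simp add: line_graph_def)

lemma card_eq_if_perfect_matching:
  assumes "\<forall>x\<in>X. \<exists>!y. y \<in> Y \<and> Q x y" and "\<forall>y\<in>Y. \<exists>!x. x \<in> X \<and> Q x y"
  shows "card X = card Y"
proof -
  define f where "f x = (THE y. y \<in> Y \<and> Q x y)" for x
  have f: "f x \<in> Y \<and> Q x (f x)" if "x \<in> X" for x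
    unfolding f_def using theI'[of "\<lambda>y. y \<in> Y \<and> Q x y"] assms(1) that by blast
  have "bij_betw f X Y"
  proof (rule bij_betwI')
    show "f x = f y \<longleftrightarrow> x = y" if "x \<in> X" "y \<in> X" for x y
      using f[OF that(1)] f[OF that(2)] assms(2) that by metis
    show "f x \<in> Y" if "x \<in> X" for x using f that by blast
    show "\<exists>x\<in>X. y = f x" if "y \<in> Y" for y
      using assms that f by metis
  qed
  then show ?thesis by (rule bij_betw_same_card)
qed

text \<open>The two path edges are distinct and contain \<open>y\<close>, so with degree 2 they
  exhaust the edges at \<open>y\<close>.\<close>

lemma edges_at_middle:
  assumes "simple_graph G" "xyz_path G (x, y, z)"
  shows "{e \<in> edges G. y \<in> e} = {{x, y}, {y, z}}"
proof -
  note p = assms(2)[unfolded xyz_path_iff[OF assms(1)]]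
  have "{{x, y}, {y, z}} \<subseteq> {e \<in> edges G. y \<in> e}" using p by auto
  moreover have "card {{x, y}, {y, z}} = 2" using p by (auto simp: doubleton_eq_iff)
  moreover have "card {e \<in> edges G. y \<in> e} = 2" using p by (auto simp: degree_def)
  moreover have "finite {e \<in> edges G. y \<in> e}" using finite_edges[OF assms(1)] by simp
  ultimately show ?thesis using card_subset_eq by metis
qed

section \<open>From the partition to the paths\<close>

lemma two_variegated_imp_paths:
  assumes G: "simple_graph G" and tv: "two_variegated (line_graph G)"
    and card: "card (edges G) = 2 * n"
  shows "\<exists>P. disjoint_xyz_paths G P \<and> card P = n \<and> no_odd_cycle G P"
proof -
  from tv obtain X Y where XY: "X \<union> Y = edges G" "X \<inter> Y = {}" "card X = card Y"
    and X: "\<forall>x\<in>X. \<exists>!y. y \<in> Y \<and> adjacent (line_graph G) x y"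
    and Y: "\<forall>y\<in>Y. \<exists>!x. x \<in> X \<and> adjacent (line_graph G) y x"
    unfolding two_variegated_def verts_line_graph by (elim exE conjE) (rule that)
  have fin: "finite X" "finite Y" using XY(1) finite_edges[OF G] by (metis finite_Un)+
  have cX: "card X = n" using card_Un_disjoint[OF fin XY(2)] XY card by simp
  have adj: "adjacent (line_graph G) e f" "adjacent (line_graph G) f e"
    if "e \<in> X" "f \<in> Y" "v \<in> e" "v \<in> f" for e f v
    using that XY unfolding adjacent_line_graph by blast+
  \<comment> \<open>The meeting points \<open>v\<close> and \<open>w\<close> may differ: equal ones
    bound the edges at a vertex, different ones exclude a chord \<open>{x, z}\<close>.\<close>
  have uX: "f = f'" if "e \<in> X" "f \<in> Y" "f' \<in> Y" "v \<in> e" "v \<in> f" "w \<in> e" "w \<in> f'" for e f f' v w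
    using bspec[OF X that(1)] adj(1)[OF that(1,2,4,5)] adj(1)[OF that(1,3,6,7)] that(2,3) by auto
  have uY: "e = e'" if "f \<in> Y" "e \<in> X" "e' \<in> X" "v \<in> e" "v \<in> f" "w \<in> e'" "w \<in> f" for e e' f v w
    using bspec[OF Y that(1)] adj(2)[OF that(2,1,4,5)] adj(2)[OF that(3,1,6,7)] that(2,3) by auto
  have edge_ne: "u \<noteq> v" if "{u, v} \<in> edges G" for u v
    using G that by (auto simp: simple_graph_def)
  \<comment> \<open>Putting the \<open>X\<close> edge first gives every path exactly one of its two
    triples.\<close>
  define P where "P = {(x, y, z). {x, y} \<in> X \<and> {y, z} \<in> Y}"
  have ne: "x \<noteq> y" "y \<noteq> z" "x \<noteq> z" if "(x, y, z) \<in> P" for x y z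
    using that XY(1,2) edge_ne[of x y] edge_ne[of y z] unfolding P_def
    by (auto simp: insert_commute)
  have at_y: "{e \<in> edges G. y \<in> e} = {{x, y}, {y, z}}" if p: "(x, y, z) \<in> P" for x y z
  proof -
    have p: "{x, y} \<in> X" "{y, z} \<in> Y" using p by (auto simp: P_def)
    \<comment> \<open>A third edge at \<open>y\<close> would be a second neighbour, in its own
      class, of the path edge from the other class.\<close>
    have "e = {x, y} \<or> e = {y, z}" if "e \<in> edges G" "y \<in> e" for e
    proof (cases "e \<in> X")
      case True
      then show ?thesis using uY[OF p(2) True p(1), of y y] that by simp
    next
      case False
      then have "e \<in> Y" using that XY by blast
      then show ?thesis using uX[OF p(1) _ p(2), of e y y] that by simp
    qed
    then show ?thesis using p XY by auto
  qed
  have path: "xyz_path G (x, y, z)" if xyz: "(x, y, z) \<in> P" for x y z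
  proof -
    have p: "{x, y} \<in> X" "{y, z} \<in> Y" using xyz by (auto simp: P_def)
    have "{x, z} \<notin> X"
    proof
      assume "{x, z} \<in> X"
      from uY[OF p(2) p(1) this, of y z] show False using ne[OF xyz] by auto
    qed
    moreover have "{x, z} \<notin> Y"
    proof
      assume "{x, z} \<in> Y"
      from uX[OF p(1) p(2) this, of y x] show False using ne[OF xyz] by auto
    qed
    moreover have "degree G y = 2"
      unfolding degree_def at_y[OF xyz] using ne[OF xyz] by (auto simp: doubleton_eq_iff)
    ultimately show ?thesis
      unfolding xyz_path_iff[OF G] using ne[OF xyz] p XY(1) by auto
  qed
  have eqX: "p = p'" if "p \<in> P" "p' \<in> P" "p = (x, y, z)" "p' = (x', y', z')" "{x, y} = {x', y'}"
    for p p' x y z x' y' z'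
  proof -
    \<comment> \<open>The \<open>X\<close> edge determines its partner in \<open>Y\<close>, and the
      middle is the only vertex that the two edges share.\<close>
    have "{y, z} = {y', z'}"
      using uX[of "{x, y}" "{y, z}" "{y', z'}" y y'] that by (auto simp: P_def)
    with that ne[of x y z] ne[of x' y' z'] show ?thesis by (auto simp: doubleton_eq_iff)
  qed
  have eqY: "p = p'" if "p \<in> P" "p' \<in> P" "p = (x, y, z)" "p' = (x', y', z')" "{y, z} = {y', z'}"
    for p p' x y z x' y' z'
  proof -
    have "{x, y} = {x', y'}"
      using uY[of "{y, z}" "{x, y}" "{x', y'}" y y'] that by (auto simp: P_def)
    with eqX that show ?thesis by blast
  qed
  \<comment> \<open>This counts the paths: there is one for each edge of \<open>X\<close>, hence
    \<open>n\<close> of them.\<close>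
  have bij: "bij_betw (\<lambda>(x, y, z). {x, y}) P X"
  proof (rule bij_betw_imageI)
    show "inj_on (\<lambda>(x, y, z). {x, y}) P"
      by (rule inj_onI) (use eqX in \<open>auto split: prod.splits\<close>)
    have "\<exists>p\<in>P. e = (case p of (x, y, z) \<Rightarrow> {x, y})" if "e \<in> X" for e
    proof -
      obtain f where f: "f \<in> Y" "adjacent (line_graph G) e f"
        using ex1_implies_ex[OF bspec[OF X \<open>e \<in> X\<close>]] by blast
      then obtain y where y: "y \<in> e" "y \<in> f" by (auto simp: adjacent_line_graph)
      have pair: "\<exists>u. g = {y, u}" if "g \<in> edges G" "y \<in> g" for g
      proof -
        have "card g = 2" using G that by (auto simp: simple_graph_def)
        then obtain a b where "g = {a, b}" by (auto simp: card_2_iff)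
        then show ?thesis using \<open>y \<in> g\<close> by (auto simp: insert_commute)
      qed
      obtain x z where "e = {y, x}" "f = {y, z}"
        using pair[of e] pair[of f] y f(1) \<open>e \<in> X\<close> XY(1) by blast
      with f(1) \<open>e \<in> X\<close> show ?thesis
        by (intro bexI[of _ "(x, y, z)"]) (auto simp: P_def insert_commute)
    qed
    then have "X \<subseteq> (\<lambda>(x, y, z). {x, y}) ` P" by blast
    then show "(\<lambda>(x, y, z). {x, y}) ` P = X" by (auto simp: P_def)
  qed
  have cP: "card P = n" using bij_betw_same_card[OF bij] cX by simp
  have finP: "finite P" using bij_betw_finite[OF bij] fin by simp
  have "pairwise (\<lambda>p p'. disjnt (path_edges p) (path_edges p')) P"
  proof (rule pairwiseI)
    fix p p' assume pp: "p \<in> P" "p' \<in> P" "p \<noteq> p'"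
    obtain x y z where p: "p = (x, y, z)" by (cases p)
    obtain x' y' z' where p': "p' = (x', y', z')" by (cases p')
    have "{x, y} \<noteq> {x', y'}" "{y, z} \<noteq> {y', z'}" using eqX[OF pp(1,2) p p'] eqY[OF pp(1,2) p p'] pp(3) by auto
    moreover have "{x, y} \<noteq> {y', z'}" "{y, z} \<noteq> {x', y'}"
      using pp XY(2) unfolding p p' P_def by auto
    ultimately show "disjnt (path_edges p) (path_edges p')"
      unfolding p p' disjnt_def by auto
  qed
  then have "disjoint_xyz_paths G P"
    unfolding disjoint_xyz_paths_def using finP path by auto
  moreover have "even (card {p \<in> P. path_edges p \<subseteq> cycle_edges c})" if cyc: "is_cycle G c" for c
  proof -
    define k where "k = length c"
    have k: "3 \<le> k" "distinct c" "cycle_edges c \<subseteq> edges G"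
      using cyc by (auto simp: is_cycle_def k_def)
    define s where "s i = Suc i mod k" for i
    have s: "s i < k" for i using k(1) by (simp add: s_def)
    define e where "e i = {c ! i, c ! s i}" for i
    have ce: "cycle_edges c = e ` {..<k}"
      unfolding cycle_edges_def e_def k_def s_def by auto
    have eE: "e i \<in> X \<or> e i \<in> Y" if "i < k" for i
      using that ce k(3) XY(1) by auto
    \<comment> \<open>These positions, where consecutive cycle edges lie in different classes, will
      correspond under \<open>g\<close> to the paths on the cycle.\<close>
    define I where "I = {i. i < k \<and> (e i \<in> X) \<noteq> (e (s i) \<in> X)}"
    define g where "g i = (if e i \<in> X then (c ! i, c ! s i, c ! s (s i))
      else (c ! s (s i), c ! s i, c ! i))" for i
    have g_edges: "path_edges (g i) = {e i, e (s i)}" for i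
      by (auto simp: g_def e_def insert_commute)
    have g_in: "g i \<in> P" if "i \<in> I" for i
      using that eE[of i] eE[OF s[of i]] XY(2) unfolding I_def g_def P_def
      by (auto simp: e_def insert_commute)
    have "bij_betw g I {p \<in> P. path_edges p \<subseteq> cycle_edges c}"
    proof (rule bij_betw_imageI)
      show "inj_on g I"
      proof (rule inj_onI)
        fix i j assume ij: "i \<in> I" "j \<in> I" "g i = g j"
        \<comment> \<open>In both orientations the middle of \<open>g i\<close> is
          \<open>c ! s i\<close>.\<close>
        then have "c ! s i = c ! s j" by (auto simp: g_def split: if_splits)
        then have "s i = s j" using k(2) s by (simp add: nth_eq_iff_index_eq k_def)
        then show "i = j" using Suc_mod_inj ij unfolding s_def I_def by blast
      qed
      have "p \<in> g ` I" if p: "p \<in> P" "path_edges p \<subseteq> cycle_edges c" for p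
      proof -
        obtain x y z where xyz: "p = (x, y, z)" by (cases p)
        have XYp: "{x, y} \<in> X" "{y, z} \<in> Y" "{x, y} \<notin> Y" "{y, z} \<notin> X"
          using p XY(2) unfolding xyz P_def by auto
        obtain a b where ab: "a < k" "b < k" "{x, y} = e a" "{y, z} = e b"
          using p(2) unfolding xyz ce by auto
        have "(b = s a \<and> x = c ! a \<and> y = c ! b \<and> z = c ! s b) \<or>
          (a = s b \<and> z = c ! b \<and> y = c ! a \<and> x = c ! s a)"
          using cycle_corner[of c a b x y z] ab k(2) XYp unfolding k_def s_def e_def by metis
        then show ?thesis
        proof
          assume h: "b = s a \<and> x = c ! a \<and> y = c ! b \<and> z = c ! s b"
          then have "a \<in> I" "g a = p" using ab XYp by (auto simp: I_def g_def xyz)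
          then show ?thesis by blast
        next
          \<comment> \<open>Here the cycle runs from \<open>z\<close> to \<open>x\<close>, so the
            change is at \<open>b\<close> and \<open>g\<close> reverses the triple.\<close>
          assume h: "a = s b \<and> z = c ! b \<and> y = c ! a \<and> x = c ! s a"
          then have "b \<in> I" "g b = p" using ab XYp by (auto simp: I_def g_def xyz)
          then show ?thesis by blast
        qed
      qed
      moreover have "path_edges (g i) \<subseteq> cycle_edges c" if "i \<in> I" for i
        unfolding g_edges ce using that s by (auto simp: I_def)
      ultimately show "g ` I = {p \<in> P. path_edges p \<subseteq> cycle_edges c}"
        using g_in by blast
    qed
    then have "card {p \<in> P. path_edges p \<subseteq> cycle_edges c} = card I"
      using bij_betw_same_card by metis
    then show ?thesis
      unfolding I_def s_def using even_card_cyclic_changes[of k "\<lambda>i. e i \<in> X"] by simp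
  qed
  ultimately show ?thesis using cP unfolding no_odd_cycle_def by blast
qed

section \<open>From the paths to the partition\<close>

fun ends :: "'v \<times> 'v \<times> 'v \<Rightarrow> 'v set" where
  "ends (x, y, z) = {x, z}"

fun middle :: "'v \<times> 'v \<times> 'v \<Rightarrow> 'v" where
  "middle (x, y, z) = y"

text \<open>This form treats both ends alike, so later arguments need not distinguish the two
  orientations of a path.\<close>

lemma path_edges_ends: "path_edges p = (\<lambda>v. {v, middle p}) ` ends p"
  by (cases p) (auto simp: insert_commute)

section \<open>Incidence and counting for disjoint paths\<close>

locale disjoint_paths =
  fixes G :: "'v graph" and P :: "('v \<times> 'v \<times> 'v) set"
  assumes G: "simple_graph G" and P: "disjoint_xyz_paths G P"
begin

lemma xyz_path: "p \<in> P \<Longrightarrow> xyz_path G p"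
  using P by (simp add: disjoint_xyz_paths_def)

lemma edges_at_middle_eq:
  assumes "p \<in> P"
  shows "{e \<in> edges G. middle p \<in> e} = path_edges p"
proof (cases p)
  case (fields x y z)
  then show ?thesis using edges_at_middle[OF G, of x y z] xyz_path[OF assms] by simp
qed

lemma path_edges_subset: "p \<in> P \<Longrightarrow> path_edges p \<subseteq> edges G"
  by (subst edges_at_middle_eq[symmetric]) auto

lemma card_path_edges:
  assumes "p \<in> P"
  shows "card (path_edges p) = 2"
proof (cases p)
  case (fields x y z)
  then show ?thesis
    using xyz_path[OF assms] xyz_path_iff[OF G, of x y z] by (simp add: doubleton_eq_iff)
qed

lemma path_eqI:
  assumes "p \<in> P" "p' \<in> P" "e \<in> path_edges p" "e \<in> path_edges p'"
  shows "p = p'"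
proof -
  have "pairwise (\<lambda>p p'. disjnt (path_edges p) (path_edges p')) P"
    using P by (simp add: disjoint_xyz_paths_def)
  then show ?thesis using assms pairwiseD disjnt_iff by metis
qed

text \<open>Otherwise the edge joining the two middles would belong to both paths. By disjointness
  they coincide, but a path does not end in its own middle.\<close>

lemma middle_notin_ends:
  assumes "p \<in> P" "p' \<in> P"
  shows "middle p \<notin> ends p'"
proof
  assume m: "middle p \<in> ends p'"
  then have e: "{middle p, middle p'} \<in> path_edges p'" by (auto simp: path_edges_ends)
  then have "{middle p, middle p'} \<in> path_edges p"
    using edges_at_middle_eq[OF assms(1)] path_edges_subset[OF assms(2)] by blast
  then have "p = p'" using e path_eqI assms by blast
  then have "middle p \<in> ends p" using m by simp
  then show False
    using xyz_path[OF assms(1)] xyz_path_iff[OF G] by (cases p) auto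
qed

lemma middle_inj:
  assumes "p \<in> P" "p' \<in> P" "middle p = middle p'"
  shows "p = p'"
proof -
  have "path_edges p = path_edges p'" using assms edges_at_middle_eq by metis
  moreover have "path_edges p \<noteq> {}" using card_path_edges[OF assms(1)] by auto
  ultimately show ?thesis using path_eqI assms by blast
qed

text \<open>Disjoint paths with two edges each cover \<open>2 * card P\<close> edges, which is all
  of them.\<close>

lemma Union_path_edges:
  assumes "card (edges G) = 2 * card P"
  shows "\<Union> (path_edges ` P) = edges G"
proof (rule card_subset_eq)
  show "finite (edges G)" by (rule finite_edges[OF G])
  show "\<Union> (path_edges ` P) \<subseteq> edges G" using path_edges_subset by blast
  have "card (\<Union> (path_edges ` P)) = (\<Sum>p\<in>P. card (path_edges p))"
  proof (rule card_UN_disjoint)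
    show "finite P" using P by (simp add: disjoint_xyz_paths_def)
    show "\<forall>p\<in>P. finite (path_edges p)" using card_path_edges card.infinite by fastforce
    show "\<forall>p\<in>P. \<forall>p'\<in>P. p \<noteq> p' \<longrightarrow> path_edges p \<inter> path_edges p' = {}"
      using path_eqI by blast
  qed
  also have "\<dots> = 2 * card P" using card_path_edges by simp
  finally show "card (\<Union> (path_edges ` P)) = card (edges G)" using assms by simp
qed

section \<open>The graph on the path ends and its odd cycles\<close>

definition ends_rel :: "('v \<times> 'v) set" where
  "ends_rel = {(u, v). \<exists>p\<in>P. ends p = {u, v}}"

text \<open>This excludes the one-vertex list, which the colouring lemma admits as an odd
  cycle.\<close>

lemma ends_rel_irrefl: "(u, u) \<notin> ends_rel"
proof
  assume "(u, u) \<in> ends_rel"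
  then obtain p where "p \<in> P" "ends p = {u}" by (auto simp: ends_rel_def)
  then show False using card_path_edges[of p] by (auto simp: path_edges_ends)
qed

text \<open>The cycle of \<open>G\<close> obtained from \<open>c\<close> by subdivision contains exactly \<open>length c\<close> paths.\<close>

lemma odd_ends_cycle_imp_odd_cycle:
  assumes c: "distinct c" "odd (length c)" "successively (\<lambda>x y. (x, y) \<in> ends_rel) (c @ [hd c])"
  shows "\<not> no_odd_cycle G P"
proof -
  define k where "k = length c"
  define s where "s i = Suc i mod k" for i
  have k0: "0 < k" using c(2) by (auto simp: k_def intro: ccontr)
  have s: "s i < k" for i using k0 by (simp add: s_def)
  have rel: "(c ! i, c ! s i) \<in> ends_rel" if "i < k" for i
  proof -
    have "((c @ [hd c]) ! i, (c @ [hd c]) ! Suc i) \<in> ends_rel"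
      using c(3) that unfolding successively_conv_nth k_def by simp
    moreover have "(c @ [hd c]) ! Suc i = c ! s i"
      using that k0 by (cases "Suc i = k") (auto simp: nth_append s_def k_def hd_conv_nth)
    ultimately show ?thesis using that by (simp add: nth_append k_def)
  qed
  have k: "3 \<le> k"
  proof -
    have "k \<noteq> 1" using rel[of 0] ends_rel_irrefl s[of 0] by auto
    then show ?thesis using c(2) k0 unfolding k_def by presburger
  qed
  \<comment> \<open>Several paths may have the same two ends; one is chosen for each pair of
    consecutive vertices.\<close>
  define p where "p i = (SOME p. p \<in> P \<and> ends p = {c ! i, c ! s i})" for i
  have p: "p i \<in> P" "ends (p i) = {c ! i, c ! s i}" if "i < k" for i
  proof -
    have "\<exists>p. p \<in> P \<and> ends p = {c ! i, c ! s i}" using rel[OF that]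
      by (simp add: ends_rel_def Bex_def del: split_paired_Ex)
    from someI_ex[OF this] show "p i \<in> P" "ends (p i) = {c ! i, c ! s i}" by (simp_all add: p_def)
  qed
  have p_inj: "inj_on p {..<k}"
  proof (rule inj_onI)
    fix i j assume ij: "i \<in> {..<k}" "j \<in> {..<k}" "p i = p j"
    then have "{c ! i, c ! s i} = {c ! j, c ! s j}" using p(2)[of i] p(2)[of j] by simp
    then show "i = j"
      using cyclic_pair_inj[OF c(1), of i j] k ij(1,2) unfolding s_def k_def by simp
  qed
  \<comment> \<open>The subdivided cycle: even positions carry the vertices of \<open>c\<close>, odd
    ones the middles of the chosen paths between them.\<close>
  define d where "d = map (\<lambda>j. if even j then c ! (j div 2) else middle (p (j div 2))) [0..<2 * k]"
  have len: "length d = 2 * k" by (simp add: d_def)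
  have d_even: "d ! (2 * i) = c ! i" if "i < k" for i using that by (simp add: d_def)
  have d_odd: "d ! Suc (2 * i) = middle (p i)" if "i < k" for i using that by (simp add: d_def)
  have ex_half: "\<exists>i<k. j = 2 * i \<or> j = Suc (2 * i)" if "j < 2 * k" for j
    using that by presburger
  \<comment> \<open>The step after the middle of \<open>p i\<close> leads to \<open>c ! s i\<close>,
    also where the cycle closes.\<close>
  have wrap: "Suc (Suc (2 * i)) mod (2 * k) = 2 * s i" for i
    unfolding s_def by (metis mult_Suc_right add_2_eq_Suc mult_mod_right)
  have nmid: "middle (p i) \<noteq> c ! j" if "i < k" "j < k" for i j
    using middle_notin_ends[OF p(1)[OF that(1)] p(1)[OF that(2)]] p(2)[OF that(2)] by auto
  have edges_d: "cycle_edges d = (\<Union>i<k. path_edges (p i))"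
  proof -
    have 1: "{d ! (2 * i), d ! (Suc (2 * i) mod (2 * k))} = {c ! i, middle (p i)}" if "i < k" for i
      using that d_even d_odd by (simp add: mod_less)
    have 2: "{d ! Suc (2 * i), d ! (Suc (Suc (2 * i)) mod (2 * k))} = {c ! s i, middle (p i)}"
      if "i < k" for i
      using that d_even[OF s] d_odd unfolding wrap by (simp add: insert_commute)
    have "cycle_edges d = (\<lambda>j. {d ! j, d ! (Suc j mod (2 * k))}) ` {..<2 * k}"
      unfolding cycle_edges_def len by auto
    also have "{..<2 * k} = (\<Union>i<k. {2 * i, Suc (2 * i)})"
      using ex_half by auto
    also have "(\<lambda>j. {d ! j, d ! (Suc j mod (2 * k))}) ` \<dots> = (\<Union>i<k. path_edges (p i))"
      unfolding image_UN using 1 2 p(2) by (auto simp: path_edges_ends)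
    finally show ?thesis .
  qed
  have "distinct d"
    unfolding distinct_conv_nth len
  proof (intro allI impI)
    fix i j assume ij: "i < 2 * k" "j < 2 * k" "i \<noteq> j"
    obtain a b where ab: "a < k" "i = 2 * a \<or> i = Suc (2 * a)" "b < k" "j = 2 * b \<or> j = Suc (2 * b)"
      using ij ex_half by metis
    have mid: "a \<noteq> b \<longrightarrow> middle (p a) \<noteq> middle (p b)"
      using middle_inj[OF p(1)[OF ab(1)] p(1)[OF ab(3)]] inj_onD[OF p_inj, of a b] ab(1,3)
      by auto
    have dist: "a \<noteq> b \<longrightarrow> c ! a \<noteq> c ! b"
      using c(1) ab by (simp add: nth_eq_iff_index_eq k_def)
    show "d ! i \<noteq> d ! j"
      using ab ij(3) mid dist nmid[of a b] nmid[of b a] d_even d_odd by auto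
  qed
  moreover have sub: "cycle_edges d \<subseteq> edges G"
    unfolding edges_d using p(1) path_edges_subset by blast
  moreover have "set d \<subseteq> verts G"
  proof
    fix v assume "v \<in> set d"
    then obtain j where "j < length d" "v = d ! j" by (auto simp: in_set_conv_nth)
    then have "\<exists>e\<in>cycle_edges d. v \<in> e" unfolding cycle_edges_def by auto
    then show "v \<in> verts G" using sub G unfolding simple_graph_def by blast
  qed
  ultimately have "is_cycle G d" unfolding is_cycle_def len using k by simp
  \<comment> \<open>A path on \<open>d\<close> shares an edge with some \<open>p i\<close> and so
    equals it by disjointness. The count is therefore the odd number \<open>k\<close>.\<close>
  moreover have "{r \<in> P. path_edges r \<subseteq> cycle_edges d} = p ` {..<k}"
  proof (intro equalityI subsetI)
    fix r assume r: "r \<in> {r \<in> P. path_edges r \<subseteq> cycle_edges d}"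
    then obtain e where "e \<in> path_edges r" using card_path_edges[of r] by fastforce
    moreover from this r obtain i where "i < k" "e \<in> path_edges (p i)" unfolding edges_d by blast
    ultimately show "r \<in> p ` {..<k}" using r path_eqI p(1) by blast
  next
    fix r assume "r \<in> p ` {..<k}"
    then show "r \<in> {r \<in> P. path_edges r \<subseteq> cycle_edges d}" unfolding edges_d using p(1) by auto
  qed
  then have "card {r \<in> P. path_edges r \<subseteq> cycle_edges d} = k"
    using card_image[OF p_inj] by simp
  ultimately show ?thesis unfolding no_odd_cycle_def using c(2) k_def by auto
qed

section \<open>The partition of the edges by colour\<close>

definition colour_class :: "('v \<Rightarrow> bool) \<Rightarrow> 'v set set" where
  "colour_class col = {{v, middle p} | v p. p \<in> P \<and> v \<in> ends p \<and> col v}"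

text \<open>Edges of opposite classes cannot meet in a path end, whose colour would have to be both,
  so they meet in a middle and are the two halves of one path. Negating \<open>col\<close> yields
  the same statement for the other class.\<close>

lemma colour_class_unique_neighbour:
  assumes col: "\<And>u v. (u, v) \<in> ends_rel \<Longrightarrow> col u \<noteq> col v" and e: "e \<in> colour_class col"
  shows "\<exists>!f. f \<in> colour_class (\<lambda>v. \<not> col v) \<and> adjacent (line_graph G) e f"
proof -
  obtain x p where x: "e = {x, middle p}" "p \<in> P" "x \<in> ends p" "col x"
    using e by (auto simp: colour_class_def)
  obtain z where z: "ends p = {x, z}" using x(3) by (cases p) auto
  then have "\<not> col z" using col[of x z] x by (auto simp: ends_rel_def)
  have pe: "path_edges p = {e, {z, middle p}}" by (simp add: path_edges_ends z x(1))
  show ?thesis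
  proof (rule ex1I[of _ "{z, middle p}"])
    have "e \<noteq> {z, middle p}" using pe card_path_edges[OF x(2)] by auto
    moreover have "e \<inter> {z, middle p} \<noteq> {}" using x(1) by simp
    ultimately have "adjacent (line_graph G) e {z, middle p}"
      using pe path_edges_subset[OF x(2)] by (simp add: adjacent_line_graph)
    moreover have "{z, middle p} \<in> colour_class (\<lambda>v. \<not> col v)"
      using x(2) z \<open>\<not> col z\<close> unfolding colour_class_def by blast
    ultimately show "{z, middle p} \<in> colour_class (\<lambda>v. \<not> col v) \<and>
        adjacent (line_graph G) e {z, middle p}" by simp
  next
    fix f assume f: "f \<in> colour_class (\<lambda>v. \<not> col v) \<and> adjacent (line_graph G) e f"
    then obtain v r where v: "f = {v, middle r}" "r \<in> P" "v \<in> ends r" "\<not> col v"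
      unfolding colour_class_def by blast
    have ne: "x \<noteq> v" "x \<noteq> middle r" "v \<noteq> middle p"
      using x(3,4) v(3,4) middle_notin_ends[OF v(2) x(2)] middle_notin_ends[OF x(2) v(2)] by auto
    have "e \<inter> f \<noteq> {}" using f by (simp add: adjacent_line_graph)
    then have "middle r = middle p"
      using ne unfolding x(1) v(1) by auto
    then have "r = p" by (rule middle_inj[OF v(2) x(2)])
    then show "f = {z, middle p}" using v(1,3) z ne(1) by auto
  qed
qed

lemma two_variegated_line_graph:
  assumes "card (edges G) = 2 * card P" and "no_odd_cycle G P"
  shows "two_variegated (line_graph G)"
proof -
  have "sym ends_rel" by (auto simp: ends_rel_def sym_def insert_commute)
  from two_colouring_if_no_odd_cycle[OF this] obtain col :: "'v \<Rightarrow> bool"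
    where col: "\<And>u v. (u, v) \<in> ends_rel \<Longrightarrow> col u \<noteq> col v"
    using odd_ends_cycle_imp_odd_cycle assms(2) by metis
  let ?X = "colour_class col" and ?Y = "colour_class (\<lambda>v. \<not> col v)"
  have X: "\<forall>x\<in>?X. \<exists>!y. y \<in> ?Y \<and> adjacent (line_graph G) x y"
    using colour_class_unique_neighbour[of col] col by blast
  have Y: "\<forall>y\<in>?Y. \<exists>!x. x \<in> ?X \<and> adjacent (line_graph G) y x"
    using colour_class_unique_neighbour[of "\<lambda>v. \<not> col v"] col by simp
  have "?X \<union> ?Y = \<Union> (path_edges ` P)"
    unfolding colour_class_def path_edges_ends by blast
  then have "?X \<union> ?Y = verts (line_graph G)"
    using Union_path_edges[OF assms(1)] by simp
  moreover have "?X \<inter> ?Y = {}"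
  proof -
    \<comment> \<open>Middles are never ends, so an edge has only one end that can determine its
      colour.\<close>
    have False if "p \<in> P" "r \<in> P" "v \<in> ends p" "u \<in> ends r" "col v" "\<not> col u"
      "{v, middle p} = {u, middle r}" for v p u r
      using that middle_notin_ends[of p r] by (auto simp: doubleton_eq_iff)
    then show ?thesis unfolding colour_class_def by blast
  qed
  moreover have "card ?X = card ?Y"
    using card_eq_if_perfect_matching[OF X] Y
    by (simp add: adjacent_def insert_commute)
  ultimately show ?thesis unfolding two_variegated_def using X Y by blast
qed

end

theorem theorem1p1:
  fixes G :: "'v graph" and q :: nat
  assumes "simple_graph G" and "card (edges G) = q"
  shows "(even q \<and> (\<exists>P. disjoint_xyz_paths G P \<and> card P = q div 2 \<and> no_odd_cycle G P)
            \<longrightarrow> two_variegated (line_graph G))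
       \<and> (\<forall>n. two_variegated (line_graph G) \<and> card (verts (line_graph G)) = 2 * n
            \<longrightarrow> (\<exists>P. disjoint_xyz_paths G P \<and> card P = n \<and> no_odd_cycle G P))"
proof (intro conjI impI allI)
  assume "even q \<and> (\<exists>P. disjoint_xyz_paths G P \<and> card P = q div 2 \<and> no_odd_cycle G P)"
  then obtain P where "even q" and paths: "disjoint_xyz_paths G P" "card P = q div 2" "no_odd_cycle G P"
    by blast
  interpret disjoint_paths G P using assms(1) paths(1) by unfold_locales
  show "two_variegated (line_graph G)"
    using two_variegated_line_graph paths(2,3) \<open>even q\<close> assms(2) by simp
next
  fix n assume "two_variegated (line_graph G) \<and> card (verts (line_graph G)) = 2 * n"
  then show "\<exists>P. disjoint_xyz_paths G P \<and> card P = n \<and> no_odd_cycle G P"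
    using two_variegated_imp_paths[OF assms(1)] by simp
qed

end
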